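(* Let $(m,n)$ and $(m',n')$ be pairs of positive integers such that $m+n=m'+n'$. If $L_{m,n}$ belongs to the lattice variety $\mathbf{V}(L_{m',n'})$ generated by $L_{m',n'}$, then $(m,n)=(m',n')$.
   Context: For a natural number $k$, $\mathbf{Co}(k)$ is the lattice of all order-convex subsets of the $k$-element chain $\{0,1,\dots,k-1\}$, ordered by inclusion (a subset $X$ is order-convex if $x\leq z\leq y$ and $x,y\in X$ imply $z\in X$). For positive integers $m,n$, $$L_{m,n}=\{X\in\mathbf{Co}(m+n+1)\mid m\in X\Rightarrow m-1\in X\},$$ a sublattice of $\mathbf{Co}(m+n+1)$. For a lattice $L$, $\mathbf{V}(L)$ denotes the variety of lattices generated by $L$. *)

theory Defs
  imports "HOL-Algebra.Lattice"
begin

text \<open>Lattices are those of HOL-Algebra: structures of type \<^typ>\<open>'a gorder\<close> satisfying the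
  locale predicate \<^const>\<open>lattice\<close>; \<^const>\<open>join\<close> and \<^const>\<open>meet\<close> are relative to the carrier.\<close>

definition order_convex :: "'a::order set \<Rightarrow> 'a set \<Rightarrow> bool" where
  "order_convex P X \<longleftrightarrow> X \<subseteq> P \<and> (\<forall>x\<in>X. \<forall>y\<in>X. \<forall>z\<in>P. x \<le> z \<and> z \<le> y \<longrightarrow> z \<in> X)"

definition Co :: "nat \<Rightarrow> nat set gorder" where
  "Co k = \<lparr>carrier = {X. order_convex {0..<k} X}, eq = (=), le = (\<subseteq>)\<rparr>"

text \<open>The subtraction \<open>m - 1\<close> below is on \<^typ>\<open>nat\<close>; it is the intended one for \<open>m > 0\<close>.\<close>

definition Lmn :: "nat \<Rightarrow> nat \<Rightarrow> nat set gorder" where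
  "Lmn m n =
     \<lparr>carrier = {X \<in> carrier (Co (m + n + 1)). m \<in> X \<longrightarrow> m - 1 \<in> X}, eq = (=), le = (\<subseteq>)\<rparr>"

datatype lterm = Var nat | Join lterm lterm | Meet lterm lterm

fun lterm_value :: "'a gorder \<Rightarrow> (nat \<Rightarrow> 'a) \<Rightarrow> lterm \<Rightarrow> 'a" where
  "lterm_value L a (Var i) = a i"
| "lterm_value L a (Join s t) = lterm_value L a s \<squnion>\<^bsub>L\<^esub> lterm_value L a t"
| "lterm_value L a (Meet s t) = lterm_value L a s \<sqinter>\<^bsub>L\<^esub> lterm_value L a t"

text \<open>An identity is a pair of terms, read as their equality.\<close>

type_synonym identity = "lterm \<times> lterm"

definition satisfies :: "'a gorder \<Rightarrow> identity \<Rightarrow> bool" where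
  "satisfies L e \<longleftrightarrow>
     (\<forall>a. range a \<subseteq> carrier L \<longrightarrow> lterm_value L a (fst e) = lterm_value L a (snd e))"

text \<open>A variety of lattices is the class of all lattices satisfying some set of identities. In HOL,
  \<open>lattice_models E\<close> is the part of that class consisting of the lattices with carrier in the
  type \<^typ>\<open>'a\<close>. Since the varieties are given by identities, the intersection
  \<open>generated_variety L\<close> is likewise the trace on \<^typ>\<open>'a\<close> of the variety generated
  by \<open>L\<close>; see \<open>generated_variety_iff\<close>.\<close>

definition lattice_models :: "identity set \<Rightarrow> 'a gorder set" where
  "lattice_models E = {K. lattice K \<and> (\<forall>e\<in>E. satisfies K e)}"

definition lattice_variety :: "'a gorder set \<Rightarrow> bool" where
  "lattice_variety V \<longleftrightarrow> (\<exists>E. V = lattice_models E)"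

definition generated_variety :: "'a gorder \<Rightarrow> 'a gorder set" where
  "generated_variety L = \<Inter>{V. lattice_variety V \<and> L \<in> V}"

lemma generated_variety_iff:
  assumes "lattice L"
  shows "K \<in> generated_variety L \<longleftrightarrow> lattice K \<and> (\<forall>e. satisfies L e \<longrightarrow> satisfies K e)"
proof
  assume K: "K \<in> generated_variety L"
  have "lattice_variety (lattice_models {e. satisfies L e} :: 'a gorder set)"
    unfolding lattice_variety_def by blast
  moreover have "L \<in> lattice_models {e. satisfies L e}"
    using assms unfolding lattice_models_def by blast
  ultimately have "K \<in> lattice_models {e. satisfies L e}"
    using K unfolding generated_variety_def by blast
  then show "lattice K \<and> (\<forall>e. satisfies L e \<longrightarrow> satisfies K e)"
    unfolding lattice_models_def by blast
next
  assume "lattice K \<and> (\<forall>e. satisfies L e \<longrightarrow> satisfies K e)"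
  then show "K \<in> generated_variety L"
    unfolding generated_variety_def lattice_variety_def lattice_models_def by blast
qed

text \<open>The sets \<open>Lmn m n\<close> and \<open>Co k\<close> are lattices, and the former is a sublattice of
  \<open>Co (m + n + 1)\<close>: the least upper bound in \<open>Co k\<close> is the convex hull of the union.\<close>

definition hull_Un :: "nat set \<Rightarrow> nat set \<Rightarrow> nat set" where
  "hull_Un X Y = {z. \<exists>x\<in>X \<union> Y. \<exists>y\<in>X \<union> Y. x \<le> z \<and> z \<le> y}"

lemma hull_Un_least:
  assumes "order_convex {0..<k} X" "order_convex {0..<k} Y"
  shows "order_convex {0..<k} (hull_Un X Y)" "X \<subseteq> hull_Un X Y" "Y \<subseteq> hull_Un X Y"
    and "\<And>Z. order_convex {0..<k} Z \<Longrightarrow> X \<subseteq> Z \<Longrightarrow> Y \<subseteq> Z \<Longrightarrow> hull_Un X Y \<subseteq> Z"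
proof -
  have lt: "x < k" if "x \<in> X \<union> Y" for x
  proof -
    have "x \<in> {0..<k}" using assms that unfolding order_convex_def by blast
    then show ?thesis by simp
  qed
  show "order_convex {0..<k} (hull_Un X Y)"
    unfolding order_convex_def
  proof (intro conjI ballI impI)
    show "hull_Un X Y \<subseteq> {0..<k}"
    proof
      fix z assume "z \<in> hull_Un X Y"
      then obtain y where "y \<in> X \<union> Y" "z \<le> y" unfolding hull_Un_def by blast
      then show "z \<in> {0..<k}" using lt[of y] by simp
    qed
  next
    fix u v z
    assume uv: "u \<in> hull_Un X Y" "v \<in> hull_Un X Y" "u \<le> z \<and> z \<le> v"
    obtain x where x: "x \<in> X \<union> Y" "x \<le> u" using uv(1) unfolding hull_Un_def by blast
    obtain y where y: "y \<in> X \<union> Y" "v \<le> y" using uv(2) unfolding hull_Un_def by blast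
    have "x \<le> z" "z \<le> y" using x(2) y(2) uv(3) by simp_all
    then show "z \<in> hull_Un X Y" using x(1) y(1) unfolding hull_Un_def by blast
  qed
  show "X \<subseteq> hull_Un X Y" "Y \<subseteq> hull_Un X Y"
    unfolding hull_Un_def by blast+
  show "hull_Un X Y \<subseteq> Z" if Z: "order_convex {0..<k} Z" "X \<subseteq> Z" "Y \<subseteq> Z" for Z
  proof
    fix z assume "z \<in> hull_Un X Y"
    then obtain x y where xy: "x \<in> X \<union> Y" "y \<in> X \<union> Y" "x \<le> z" "z \<le> y"
      unfolding hull_Un_def by blast
    then have "z \<in> {0..<k}" using lt[of y] by simp
    then show "z \<in> Z" using Z xy unfolding order_convex_def by blast
  qed
qed

lemma order_convex_Int:
  "order_convex P X \<Longrightarrow> order_convex P Y \<Longrightarrow> order_convex P (X \<inter> Y)"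
  unfolding order_convex_def by blast

lemma hull_Un_Lmn:
  assumes "m \<in> X \<longrightarrow> m - 1 \<in> X" "m \<in> Y \<longrightarrow> m - 1 \<in> Y" "m \<in> hull_Un X Y"
  shows "m - 1 \<in> hull_Un X Y"
proof -
  obtain x y where xy: "x \<in> X \<union> Y" "y \<in> X \<union> Y" "x \<le> m" "m \<le> y"
    using assms(3) unfolding hull_Un_def by blast
  then have "\<exists>x'\<in>X \<union> Y. x' \<le> m - 1"
  proof (cases "x = m")
    case True
    then show ?thesis using assms(1,2) xy(1) by blast
  next
    case False
    then have "x \<le> m - 1" using xy(3) by simp
    then show ?thesis using xy(1) by blast
  qed
  moreover have "m - 1 \<le> y" using xy by simp
  ultimately show ?thesis using xy unfolding hull_Un_def by blast
qed

lemma lattice_inclusion: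
  assumes "\<And>X Y. X \<in> C \<Longrightarrow> Y \<in> C \<Longrightarrow> X \<inter> Y \<in> C"
    and "\<And>X Y. X \<in> C \<Longrightarrow> Y \<in> C \<Longrightarrow> J X Y \<in> C \<and> X \<subseteq> J X Y \<and> Y \<subseteq> J X Y"
    and "\<And>X Y Z. X \<in> C \<Longrightarrow> Y \<in> C \<Longrightarrow> Z \<in> C \<Longrightarrow> X \<subseteq> Z \<Longrightarrow> Y \<subseteq> Z \<Longrightarrow> J X Y \<subseteq> Z"
  defines "L \<equiv> \<lparr>carrier = C, eq = (=), le = (\<subseteq>)\<rparr>"
  shows "lattice L"
    and "\<And>X Y. X \<in> C \<Longrightarrow> Y \<in> C \<Longrightarrow> X \<squnion>\<^bsub>L\<^esub> Y = J X Y"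
    and "\<And>X Y. X \<in> C \<Longrightarrow> Y \<in> C \<Longrightarrow> X \<sqinter>\<^bsub>L\<^esub> Y = X \<inter> Y"
proof -
  have po: "partial_order L"
    unfolding L_def by unfold_locales auto
  have lub: "least L (J X Y) (Upper L {X, Y})" if "X \<in> C" "Y \<in> C" for X Y
    using assms(2,3) that unfolding L_def least_def Upper_def by auto
  have glb: "greatest L (X \<inter> Y) (Lower L {X, Y})" if "X \<in> C" "Y \<in> C" for X Y
    using assms(1) that unfolding L_def greatest_def Lower_def by auto
  have C: "carrier L = C" unfolding L_def by simp
  show lat: "lattice L"
    unfolding lattice_def upper_semilattice_def lower_semilattice_def
      upper_semilattice_axioms_def lower_semilattice_axioms_def C
    using po lub glb by blast
  interpret lattice L by (rule lat)
  show "X \<squnion>\<^bsub>L\<^esub> Y = J X Y" if "X \<in> C" "Y \<in> C" for X Y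
    using least_unique[OF _ lub[OF that]] sup_of_two_least[of X Y] that C
    unfolding join_def by simp
  show "X \<sqinter>\<^bsub>L\<^esub> Y = X \<inter> Y" if "X \<in> C" "Y \<in> C" for X Y
    using greatest_unique[OF _ glb[OF that]] inf_of_two_greatest[of X Y] that C
    unfolding meet_def by simp
qed

lemma Co_lattice:
  shows "lattice (Co k)"
    and "X \<in> carrier (Co k) \<Longrightarrow> Y \<in> carrier (Co k) \<Longrightarrow> X \<squnion>\<^bsub>Co k\<^esub> Y = hull_Un X Y"
    and "X \<in> carrier (Co k) \<Longrightarrow> Y \<in> carrier (Co k) \<Longrightarrow> X \<sqinter>\<^bsub>Co k\<^esub> Y = X \<inter> Y"
proof -
  let ?C = "{X. order_convex {0..<k} X}"
  note I = lattice_inclusion[of ?C hull_Un]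
  have 1: "\<And>X Y. X \<in> ?C \<Longrightarrow> Y \<in> ?C \<Longrightarrow> X \<inter> Y \<in> ?C"
    by (simp add: order_convex_Int)
  have 2: "\<And>X Y. X \<in> ?C \<Longrightarrow> Y \<in> ?C \<Longrightarrow>
      hull_Un X Y \<in> ?C \<and> X \<subseteq> hull_Un X Y \<and> Y \<subseteq> hull_Un X Y"
    by (simp add: hull_Un_least)
  have 3: "\<And>X Y Z. X \<in> ?C \<Longrightarrow> Y \<in> ?C \<Longrightarrow> Z \<in> ?C \<Longrightarrow> X \<subseteq> Z \<Longrightarrow> Y \<subseteq> Z \<Longrightarrow> hull_Un X Y \<subseteq> Z"
    using hull_Un_least(4) by blast
  show "lattice (Co k)"
    unfolding Co_def by (rule I(1)[OF 1 2 3])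
  show "X \<in> carrier (Co k) \<Longrightarrow> Y \<in> carrier (Co k) \<Longrightarrow> X \<squnion>\<^bsub>Co k\<^esub> Y = hull_Un X Y"
    using I(2)[OF 1 2 3] unfolding Co_def by simp
  show "X \<in> carrier (Co k) \<Longrightarrow> Y \<in> carrier (Co k) \<Longrightarrow> X \<sqinter>\<^bsub>Co k\<^esub> Y = X \<inter> Y"
    using I(3)[OF 1 2 3] unfolding Co_def by simp
qed

lemma Lmn_sublattice:
  shows "carrier (Lmn m n) \<subseteq> carrier (Co (m + n + 1))"
    and "lattice (Lmn m n)"
    and "X \<in> carrier (Lmn m n) \<Longrightarrow> Y \<in> carrier (Lmn m n) \<Longrightarrow>
      X \<squnion>\<^bsub>Lmn m n\<^esub> Y = X \<squnion>\<^bsub>Co (m + n + 1)\<^esub> Y"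
    and "X \<in> carrier (Lmn m n) \<Longrightarrow> Y \<in> carrier (Lmn m n) \<Longrightarrow>
      X \<sqinter>\<^bsub>Lmn m n\<^esub> Y = X \<sqinter>\<^bsub>Co (m + n + 1)\<^esub> Y"
proof -
  let ?k = "m + n + 1"
  let ?C = "{X \<in> carrier (Co ?k). m \<in> X \<longrightarrow> m - 1 \<in> X}"
  have Co: "\<And>X k. X \<in> carrier (Co k) \<longleftrightarrow> order_convex {0..<k} X"
    unfolding Co_def by simp
  note I = lattice_inclusion[of ?C hull_Un]
  have 1: "\<And>X Y. X \<in> ?C \<Longrightarrow> Y \<in> ?C \<Longrightarrow> X \<inter> Y \<in> ?C"
    using order_convex_Int unfolding Co by blast
  have 2: "\<And>X Y. X \<in> ?C \<Longrightarrow> Y \<in> ?C \<Longrightarrow>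
      hull_Un X Y \<in> ?C \<and> X \<subseteq> hull_Un X Y \<and> Y \<subseteq> hull_Un X Y"
  proof -
    fix X Y assume X: "X \<in> ?C" and Y: "Y \<in> ?C"
    then have cv: "order_convex {0..<?k} X" "order_convex {0..<?k} Y"
      and mX: "m \<in> X \<longrightarrow> m - 1 \<in> X" and mY: "m \<in> Y \<longrightarrow> m - 1 \<in> Y"
      using Co by auto
    have "m \<in> hull_Un X Y \<longrightarrow> m - 1 \<in> hull_Un X Y"
      using hull_Un_Lmn[OF mX mY] by blast
    then show "hull_Un X Y \<in> ?C \<and> X \<subseteq> hull_Un X Y \<and> Y \<subseteq> hull_Un X Y"
      using hull_Un_least(1-3)[OF cv] Co by blast
  qed
  have 3: "\<And>X Y Z. X \<in> ?C \<Longrightarrow> Y \<in> ?C \<Longrightarrow> Z \<in> ?C \<Longrightarrow> X \<subseteq> Z \<Longrightarrow> Y \<subseteq> Z \<Longrightarrow> hull_Un X Y \<subseteq> Z"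
    by (rule hull_Un_least(4)[where k = ?k]) (simp_all add: Co)
  show "carrier (Lmn m n) \<subseteq> carrier (Co ?k)"
    unfolding Lmn_def by auto
  show "lattice (Lmn m n)"
    unfolding Lmn_def by (rule I(1)[OF 1 2 3])
  show "X \<in> carrier (Lmn m n) \<Longrightarrow> Y \<in> carrier (Lmn m n) \<Longrightarrow>
      X \<squnion>\<^bsub>Lmn m n\<^esub> Y = X \<squnion>\<^bsub>Co ?k\<^esub> Y"
    using I(2)[OF 1 2 3, of X Y] Co_lattice(2)[of X ?k Y] unfolding Lmn_def by simp
  show "X \<in> carrier (Lmn m n) \<Longrightarrow> Y \<in> carrier (Lmn m n) \<Longrightarrow>
      X \<sqinter>\<^bsub>Lmn m n\<^esub> Y = X \<sqinter>\<^bsub>Co ?k\<^esub> Y"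
    using I(3)[OF 1 2 3, of X Y] Co_lattice(3)[of X ?k Y] unfolding Lmn_def by simp
qed

end

theory Submission
  imports Defs
begin

text \<open>The lattice \<open>L\<^sub>m\<^sub>,\<^sub>n\<close> is subdirectly irreducible, so by Jonsson's lemma it is a homomorphic
  image of a sublattice of \<open>L\<^sub>m\<^sub>'\<^sub>,\<^sub>n\<^sub>'\<close>. The least preimages of the \<open>m + n + 1\<close> join-irreducible
  elements of \<open>L\<^sub>m\<^sub>,\<^sub>n\<close> are intervals, and least preimages turn inclusions between joins into
  inclusions between joins. This forces one family of endpoints of these intervals to be strictly
  monotone; as there are as many intervals as points, the endpoints are then determined, no left
  endpoint being \<open>m'\<close>. For \<open>m \<noteq> m'\<close> this leaves a single configuration, which a meet of two of the
  intervals rules out.\<close>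

section \<open>Evaluation of lattice terms by hulls and intersections\<close>

fun eval_hull :: "(nat \<Rightarrow> nat set) \<Rightarrow> lterm \<Rightarrow> nat set" where
  "eval_hull a (Var i) = a i"
| "eval_hull a (Join s t) = hull_Un (eval_hull a s) (eval_hull a t)"
| "eval_hull a (Meet s t) = eval_hull a s \<inter> eval_hull a t"

fun lterm_vars :: "lterm \<Rightarrow> nat set" where
  "lterm_vars (Var i) = {i}"
| "lterm_vars (Join s t) = lterm_vars s \<union> lterm_vars t"
| "lterm_vars (Meet s t) = lterm_vars s \<union> lterm_vars t"

lemma eval_hull_cong:
  "(\<And>i. i \<in> lterm_vars t \<Longrightarrow> a i = b i) \<Longrightarrow> eval_hull a t = eval_hull b t"
  by (induction t) auto

lemma carrier_Lmn_iff:
  "X \<in> carrier (Lmn m n) \<longleftrightarrow> order_convex {0..m + n} X \<and> (m \<in> X \<longrightarrow> m - 1 \<in> X)"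
  by (simp add: Lmn_def Co_def atLeastLessThanSuc_atLeastAtMost)

lemma carrier_Lmn_subset: "X \<in> carrier (Lmn m n) \<Longrightarrow> X \<subseteq> {0..m + n}"
  unfolding carrier_Lmn_iff order_convex_def by (elim conjE)

lemma finite_carrier_Lmn: "finite (carrier (Lmn m n))"
  by (rule finite_subset[of _ "Pow {0..m + n}"]) (use carrier_Lmn_subset in blast, simp)

text \<open>Joins and meets are inherited from \<open>Co (m + n + 1)\<close>, where they are convex
  hulls of unions and intersections. Neither operation mentions \<open>m\<close> or
  \<open>n\<close>, so \<open>eval_hull\<close> serves both lattices to be compared.\<close>

lemma lterm_value_Lmn:
  assumes "range a \<subseteq> carrier (Lmn m n)"
  shows "lterm_value (Lmn m n) a t = eval_hull a t \<and> eval_hull a t \<in> carrier (Lmn m n)"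
proof -
  interpret lattice "Lmn m n" by (rule Lmn_sublattice(2))
  show ?thesis
  proof (induction t)
    case (Var i)
    then show ?case using assms by auto
  next
    case (Join s t)
    then have *: "eval_hull a s \<in> carrier (Lmn m n)" "eval_hull a t \<in> carrier (Lmn m n)"
      by auto
    then have co: "eval_hull a s \<in> carrier (Co (m + n + 1))"
        "eval_hull a t \<in> carrier (Co (m + n + 1))"
      using Lmn_sublattice(1) by auto
    have "eval_hull a s \<squnion>\<^bsub>Lmn m n\<^esub> eval_hull a t = hull_Un (eval_hull a s) (eval_hull a t)"
      using Lmn_sublattice(3)[OF *] Co_lattice(2)[OF co] by simp
    moreover have "eval_hull a s \<squnion>\<^bsub>Lmn m n\<^esub> eval_hull a t \<in> carrier (Lmn m n)"
      using * by simp
    ultimately show ?case using Join by simp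
  next
    case (Meet s t)
    then have *: "eval_hull a s \<in> carrier (Lmn m n)" "eval_hull a t \<in> carrier (Lmn m n)"
      by auto
    then have co: "eval_hull a s \<in> carrier (Co (m + n + 1))"
        "eval_hull a t \<in> carrier (Co (m + n + 1))"
      using Lmn_sublattice(1) by auto
    have "eval_hull a s \<sqinter>\<^bsub>Lmn m n\<^esub> eval_hull a t = eval_hull a s \<inter> eval_hull a t"
      using Lmn_sublattice(4)[OF *] Co_lattice(3)[OF co] by simp
    moreover have "eval_hull a s \<sqinter>\<^bsub>Lmn m n\<^esub> eval_hull a t \<in> carrier (Lmn m n)"
      using * by simp
    ultimately show ?case using Meet by simp
  qed
qed

lemma satisfies_Lmn_iff:
  "satisfies (Lmn m n) (s, t) \<longleftrightarrow>
     (\<forall>a. range a \<subseteq> carrier (Lmn m n) \<longrightarrow> eval_hull a s = eval_hull a t)"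
  unfolding satisfies_def fst_conv snd_conv by (metis lterm_value_Lmn)

text \<open>The values at \<open>0, \<dots>, m + n\<close> are the join-irreducible elements of \<open>L\<^sub>m\<^sub>,\<^sub>n\<close>.\<close>

definition generator :: "nat \<Rightarrow> nat \<Rightarrow> nat \<Rightarrow> nat set" where
  "generator m n i = (if i = m then {m - 1, m} else if i \<le> m + n then {i} else {})"

lemma range_generator: "range (generator m n) \<subseteq> carrier (Lmn m n)"
  by (auto simp: generator_def carrier_Lmn_iff order_convex_def)

lemma subset_hull_Un: "X \<subseteq> hull_Un X Y" "Y \<subseteq> hull_Un X Y"
  by (auto simp: hull_Un_def)

lemma hull_Un_empty: "hull_Un {} {x} = {x}"
  by (auto simp: hull_Un_def)

lemma hull_Un_mono: "X \<subseteq> X' \<Longrightarrow> Y \<subseteq> Y' \<Longrightarrow> hull_Un X Y \<subseteq> hull_Un X' Y'"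
  unfolding hull_Un_def by (intro Collect_mono impI) (elim bexE, intro bexI, auto)

lemma hull_Un_atLeastAtMost:
  assumes "a \<le> b" "c \<le> d"
  shows "hull_Un {a..b} {c..d} = {min a c..max b d}"
proof
  show "hull_Un {a..b} {c..d} \<subseteq> {min a c..max b d}"
    by (auto simp: hull_Un_def min_def max_def)
  show "{min a c..max b d} \<subseteq> hull_Un {a..b} {c..d}"
  proof
    fix z assume z: "z \<in> {min a c..max b d}"
    have "min a c \<in> {a..b} \<union> {c..d}" "max b d \<in> {a..b} \<union> {c..d}"
      using assms by (auto simp: min_def max_def)
    then show "z \<in> hull_Un {a..b} {c..d}"
      using z unfolding hull_Un_def by fastforce
  qed
qed

section \<open>Separating terms and Jonsson's lemma\<close>

text \<open>Subdirect irreducibility: any failure of an inclusion in \<open>L\<^sub>m\<^sub>,\<^sub>n\<close> is moved by a lattice polynomial to the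
  join-irreducible element \<open>{m - 1, m}\<close> and its lower cover, the critical quotient of the monolith.\<close>

lemma separate_at_critical_quotient:
  assumes mn: "m > 0" "n > 0"
    and st: "lterm_vars s \<subseteq> {..m + n}" "lterm_vars t \<subseteq> {..m + n}"
    and sub: "eval_hull a s \<subseteq> eval_hull a t"
    and nsub: "\<not> eval_hull (generator m n) s \<subseteq> eval_hull (generator m n) t"
  obtains s' t' where "lterm_vars s' \<subseteq> {..m + n}" "lterm_vars t' \<subseteq> {..m + n}"
    "eval_hull a s' \<subseteq> eval_hull a t'"
    "{m - 1, m} \<subseteq> eval_hull (generator m n) s'" "m \<notin> eval_hull (generator m n) t'"
proof -
  let ?g = "generator m n"
  obtain i where i: "i \<in> eval_hull ?g s" "i \<notin> eval_hull ?g t" using nsub by blast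
  have cs: "eval_hull ?g s \<in> carrier (Lmn m n)"
    using lterm_value_Lmn[OF range_generator] by blast
  then have iN: "i \<le> m + n" using i carrier_Lmn_subset by fastforce
  show ?thesis
  proof (cases "i = m")
    case True
    then show ?thesis using that[of s t] i st sub cs by (auto simp: carrier_Lmn_iff)
  next
    case False
    \<comment> \<open>The point \<open>j\<close> is the neighbour of \<open>m\<close> on the side
      away from \<open>i\<close>, so the hull of \<open>i\<close> and \<open>j\<close> contains
      \<open>m - 1\<close> and \<open>m\<close>. Meeting with \<open>i\<close> leaves
      \<open>{i}\<close> for \<open>s\<close> and nothing for \<open>t\<close>; joining
      \<open>j\<close> then gives this hull for \<open>s\<close> and only \<open>{j}\<close> for
      \<open>t\<close>.\<close>
    define j where "j = (if i < m then m + 1 else m - 1)"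
    define p where "p r = Join (Meet r (Var i)) (Var j)" for r
    have jN: "j \<le> m + n" and jm: "j \<noteq> m" using mn by (auto simp: j_def)
    have gi: "?g i = {i}" "?g j = {j}" using iN jN jm False by (auto simp: generator_def)
    show ?thesis
    proof (rule that[of "p s" "p t"])
      show "lterm_vars (p s) \<subseteq> {..m + n}" "lterm_vars (p t) \<subseteq> {..m + n}"
        using st iN jN by (auto simp: p_def)
      show "eval_hull a (p s) \<subseteq> eval_hull a (p t)"
        unfolding p_def eval_hull.simps by (intro hull_Un_mono Int_mono sub subset_refl)
      have "eval_hull ?g s \<inter> {i} = {i}" using i by auto
      then have "eval_hull ?g (p s) = {min i j..max i j}"
        using hull_Un_atLeastAtMost[of i i j j] by (simp add: p_def gi)
      then show "{m - 1, m} \<subseteq> eval_hull ?g (p s)"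
        using False by (auto simp: j_def)
      have "eval_hull ?g t \<inter> {i} = {}" using i by auto
      then have "eval_hull ?g (p t) = {j}"
        by (simp add: p_def gi hull_Un_empty)
      then show "m \<notin> eval_hull ?g (p t)"
        using jm by simp
    qed
  qed
qed

lemma eval_foldr_Meet:
  "eval_hull a (foldr (\<lambda>x. Meet (f x)) xs u) = (\<Inter>x\<in>set xs. eval_hull a (f x)) \<inter> eval_hull a u"
  by (induction xs) auto

lemma eval_foldr_Join_upper:
  "x \<in> set xs \<Longrightarrow> eval_hull a (f x) \<subseteq> eval_hull a (foldr (\<lambda>x. Join (f x)) xs u)"
proof (induction xs)
  case (Cons y ys)
  show ?case
  proof (cases "x = y")
    case True
    then show ?thesis by (simp add: subset_hull_Un)
  next
    case False
    then show ?thesis using Cons subset_trans[OF _ subset_hull_Un(2)] by simp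
  qed
qed simp

lemma eval_foldr_Join_singleton:
  assumes "\<And>x. x \<in> set xs \<Longrightarrow> eval_hull a (f x) \<subseteq> {c}" "eval_hull a u \<subseteq> {c}"
  shows "eval_hull a (foldr (\<lambda>x. Join (f x)) xs u) \<subseteq> {c}"
  using assms
proof (induction xs)
  case (Cons y ys)
  then have "eval_hull a (f y) \<subseteq> {c}" "eval_hull a (foldr (\<lambda>x. Join (f x)) ys u) \<subseteq> {c}"
    by auto
  from hull_Un_mono[OF this] show ?case
    using hull_Un_atLeastAtMost[of c c c c] by simp
qed simp

lemma lterm_vars_foldr:
  "lterm_vars (foldr (\<lambda>x. Meet (f x)) xs u) = (\<Union>x\<in>set xs. lterm_vars (f x)) \<union> lterm_vars u"
  "lterm_vars (foldr (\<lambda>x. Join (f x)) xs u) = (\<Union>x\<in>set xs. lterm_vars (f x)) \<union> lterm_vars u"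
  by (induction xs) auto

text \<open>Jonsson's lemma for the subdirectly irreducible lattice \<open>L\<^sub>m\<^sub>,\<^sub>n\<close>: the subalgebra
  generated by the range of \<open>a\<close> maps homomorphically onto \<open>L\<^sub>m\<^sub>,\<^sub>n\<close>. If no \<open>a\<close> works, the finitely many
  failures, all moved to the critical quotient, combine into a single identity.\<close>

lemma quotient_of_sublattice:
  assumes mn: "m > 0" "n > 0"
    and var: "Lmn m n \<in> generated_variety (Lmn m' n')"
  obtains a where "range a \<subseteq> carrier (Lmn m' n')"
    "\<And>s t. lterm_vars s \<subseteq> {..m + n} \<Longrightarrow> lterm_vars t \<subseteq> {..m + n} \<Longrightarrow>
       eval_hull a s \<subseteq> eval_hull a t \<Longrightarrow>
       eval_hull (generator m n) s \<subseteq> eval_hull (generator m n) t"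
proof (rule ccontr)
  note witness = that
  assume contra: "\<not> thesis"
  let ?N = "m + n" and ?g = "generator m n" and ?C = "carrier (Lmn m' n')"
  \<comment> \<open>Fixing the value \<open>{}\<close> outside the relevant variables makes the set
    of assignments finite.\<close>
  define A where "A = {a. \<forall>i. (i \<in> {..?N} \<longrightarrow> a i \<in> ?C) \<and> (i \<notin> {..?N} \<longrightarrow> a i = {})}"
  define P where "P a s t \<longleftrightarrow> lterm_vars s \<subseteq> {..?N} \<and> lterm_vars t \<subseteq> {..?N} \<and>
      eval_hull a s \<subseteq> eval_hull a t \<and> {m - 1, m} \<subseteq> eval_hull ?g s \<and> m \<notin> eval_hull ?g t" for a s t
  have empty: "{} \<in> ?C" by (simp add: carrier_Lmn_iff order_convex_def)
  have "\<exists>s t. P a s t" if "a \<in> A" for a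
  proof -
    have "range a \<subseteq> ?C"
    proof (rule image_subsetI)
      fix i show "a i \<in> ?C" using that empty by (cases "i \<in> {..?N}") (auto simp: A_def)
    qed
    from witness[OF this] obtain s t where st: "lterm_vars s \<subseteq> {..?N}" "lterm_vars t \<subseteq> {..?N}"
      "eval_hull a s \<subseteq> eval_hull a t" "\<not> eval_hull ?g s \<subseteq> eval_hull ?g t"
      using contra by metis
    show ?thesis
      by (rule separate_at_critical_quotient[OF mn st]) (unfold P_def, intro exI conjI)
  qed
  then obtain S T where "\<And>a. a \<in> A \<Longrightarrow> P a (S a) (T a)" by metis
  then have ST: "\<And>a. a \<in> A \<Longrightarrow> lterm_vars (S a) \<subseteq> {..?N}"
      "\<And>a. a \<in> A \<Longrightarrow> lterm_vars (T a) \<subseteq> {..?N}"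
      "\<And>a. a \<in> A \<Longrightarrow> eval_hull a (S a) \<subseteq> eval_hull a (T a)"
      "\<And>a. a \<in> A \<Longrightarrow> {m - 1, m} \<subseteq> eval_hull ?g (S a)"
      "\<And>a. a \<in> A \<Longrightarrow> m \<notin> eval_hull ?g (T a)"
    unfolding P_def by simp_all
  have "finite A"
    unfolding A_def by (rule finite_set_of_finite_funs) (auto simp: finite_carrier_Lmn)
  then obtain xs where xs: "set xs = A" using finite_list by blast
  \<comment> \<open>The inclusion of \<open>w\<close> in \<open>v\<close> holds under every
    assignment in \<open>A\<close>, as there \<open>w\<close> lies below \<open>S a\<close>, hence
    below \<open>T a\<close>. Under the generators it fails: the \<open>Var m\<close> in
    \<open>w\<close> cuts its value down to \<open>{m - 1, m}\<close>, and no \<open>T a\<close>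
    contains \<open>m\<close>, so \<open>v\<close> stays inside \<open>{m - 1}\<close>.\<close>
  define w where "w = foldr (\<lambda>a. Meet (S a)) xs (Var m)"
  define v where "v = foldr (\<lambda>a. Join (Meet w (T a))) xs (Var (m - 1))"
  have vars: "lterm_vars w \<subseteq> {..?N}" "lterm_vars v \<subseteq> {..?N}"
    using ST(1,2) by (auto simp: w_def v_def lterm_vars_foldr xs)
  have "satisfies (Lmn m' n') (Meet w v, w)"
    unfolding satisfies_Lmn_iff
  proof (intro allI impI)
    fix a :: "nat \<Rightarrow> nat set" assume a: "range a \<subseteq> ?C"
    define b where "b i = (if i \<le> ?N then a i else {})" for i
    have b: "b \<in> A" using a by (auto simp: b_def A_def)
    have ab: "eval_hull a r = eval_hull b r" if "lterm_vars r \<subseteq> {..?N}" for r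
      using that by (intro eval_hull_cong) (auto simp: b_def)
    have "eval_hull b w \<subseteq> eval_hull b (S b)"
      using b by (auto simp: w_def eval_foldr_Meet xs)
    then have "eval_hull b w \<subseteq> eval_hull b (Meet w (T b))" using ST(3)[OF b] by auto
    also have "\<dots> \<subseteq> eval_hull b v"
      unfolding v_def using b xs by (intro eval_foldr_Join_upper) auto
    finally show "eval_hull a (Meet w v) = eval_hull a w"
      using ab vars by auto
  qed
  then have "satisfies (Lmn m n) (Meet w v, w)"
    using var generated_variety_iff[OF Lmn_sublattice(2)] by blast
  then have "eval_hull ?g w \<subseteq> eval_hull ?g v"
    unfolding satisfies_Lmn_iff using range_generator by (simp add: inf.absorb_iff1)
  moreover have w: "eval_hull ?g w = {m - 1, m}"
    using ST(4) by (auto simp: w_def eval_foldr_Meet xs generator_def)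
  moreover have "eval_hull ?g v \<subseteq> {m - 1}"
    unfolding v_def
    by (rule eval_foldr_Join_singleton) (use ST(5) mn w in \<open>auto simp: xs generator_def\<close>)
  ultimately show False using mn by auto
qed

section \<open>Least preimages and the rigidity of their endpoints\<close>

lemma least_preimage:
  assumes fin: "finite (eval_hull a u)" and u: "lterm_vars u \<subseteq> {..N}"
  obtains b where "lterm_vars b \<subseteq> {..N}" "eval_hull g b = eval_hull g u"
    "\<And>t. lterm_vars t \<subseteq> {..N} \<Longrightarrow> eval_hull g u \<subseteq> eval_hull g t \<Longrightarrow> eval_hull a b \<subseteq> eval_hull a t"
proof -
  let ?P = "\<lambda>b. lterm_vars b \<subseteq> {..N} \<and> eval_hull g b = eval_hull g u \<and> finite (eval_hull a b)"
  \<comment> \<open>Minimal cardinality gives leastness: meeting \<open>b\<close> with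
    \<open>t\<close> keeps the value under \<open>g\<close>, so it cannot shrink the value under
    \<open>a\<close>.\<close>
  obtain b where b: "?P b" "\<And>t. ?P t \<Longrightarrow> card (eval_hull a b) \<le> card (eval_hull a t)"
    using ex_has_least_nat[of ?P u "\<lambda>b. card (eval_hull a b)"] fin u by blast
  show ?thesis
  proof (rule that[of b])
    fix t assume t: "lterm_vars t \<subseteq> {..N}" "eval_hull g u \<subseteq> eval_hull g t"
    have "card (eval_hull a b) \<le> card (eval_hull a (Meet b t))"
      by (rule b(2)) (use b t in auto)
    then have "eval_hull a b \<inter> eval_hull a t = eval_hull a b"
      using b(1) by (intro card_seteq) auto
    then show "eval_hull a b \<subseteq> eval_hull a t" by blast
  qed (use b in auto)
qed

lemma increasing_ge_shift:
  fixes f :: "nat \<Rightarrow> nat"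
  assumes "\<And>i. k \<le> i \<Longrightarrow> i < N \<Longrightarrow> f i < f (Suc i)" "k \<le> i" "i \<le> N"
  shows "f k + (i - k) \<le> f i"
  using assms(2,3)
proof (induction i rule: dec_induct)
  case (step i)
  then show ?case using assms(1)[of i] by simp
qed simp

text \<open>Here \<open>lo\<close> and \<open>hi\<close> stand for the endpoints of the least
  preimages and \<open>p\<close> for \<open>m'\<close>. The hypotheses \<open>span\<close>,
  \<open>below\<close>, \<open>above\<close> and \<open>crit\<close> are inclusions and
  non-inclusions between joins of generators, read off on endpoints. The two cases are the two
  possible orientations of the chain.\<close>

lemma interval_ranks:
  fixes lo hi :: "nat \<Rightarrow> nat"
  assumes m: "0 < m" "m < N" and p: "p \<le> N"
    and bnd: "\<And>i. i \<le> N \<Longrightarrow> lo i \<le> hi i" "\<And>i. i \<le> N \<Longrightarrow> hi i \<le> N" "\<And>i. i \<le> N \<Longrightarrow> lo i \<noteq> p"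
    and span: "\<And>i. i \<le> N \<Longrightarrow> min (lo 0) (lo N) \<le> lo i \<and> hi i \<le> max (hi 0) (hi N)"
    and below: "\<And>i j. j < i \<Longrightarrow> i \<le> N \<Longrightarrow> \<not> (min (lo 0) (lo j) \<le> lo i \<and> hi i \<le> max (hi 0) (hi j))"
    and above: "\<And>i k. i < k \<Longrightarrow> k \<le> N \<Longrightarrow> \<not> (i = m - 1 \<and> k = m) \<Longrightarrow>
       \<not> (min (lo k) (lo N) \<le> lo i \<and> hi i \<le> max (hi k) (hi N))"
    and crit: "lo m \<le> lo (m - 1)"
    and ne: "p \<noteq> m"
  shows "lo (m - 1) = m - 1 \<and> lo m = m - 1 \<and> lo (Suc m) = m \<and> (\<forall>i\<le>N. hi i = i)"
proof (cases "lo 0 < lo N")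
  case True
  \<comment> \<open>Now \<open>span\<close> gives \<open>lo 0\<close> \<le> \<open>lo i\<close> and
    \<open>hi i\<close> \<le> \<open>hi N\<close>. So only the condition on \<open>hi\<close> can
    fail in \<open>below\<close>, and only the one on \<open>lo\<close> in
    \<open>above\<close>.\<close>
  have "hi 0 < hi N" using below[of 0 N] True m by auto
  have hi_less: "hi j < hi i" if "j < i" "i \<le> N" for i j
    using below[OF that] span[of i] that True by auto
  have lo_less: "lo i < lo k" if "i < k" "k \<le> N" "\<not> (i = m - 1 \<and> k = m)" for i k
    using above[OF that] span[of i] that \<open>hi 0 < hi N\<close> by auto
  \<comment> \<open>A strictly increasing map of \<open>{0..N}\<close> into itself is the
    identity.\<close>
  have hi: "hi i = i" if "i \<le> N" for i
    using increasing_ge_shift[of 0 N hi i] increasing_ge_shift[of i N hi N] hi_less bnd(2)[of N] that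
    by auto
  have lo_le: "lo i \<le> i" if "i \<le> N" for i using bnd(1) hi that by fastforce
  have lo_left: "lo i = i" if "i < m" for i
  proof -
    have "lo 0 + (i - 0) \<le> lo i"
      by (rule increasing_ge_shift[of 0 "m - 1"]) (use that m in \<open>auto intro!: lo_less\<close>)
    then show ?thesis using lo_le[of i] that m by simp
  qed
  then have "m < p" using bnd(3)[of p] ne p m by (cases "p < m") auto
  have lo_m: "lo m = m - 1"
  proof -
    \<comment> \<open>The pair \<open>m - 1\<close>, \<open>m\<close> is exempt from strict growth,
      so the bound comes from \<open>m - 2\<close>, which exists unless
      \<open>m = 1\<close>.\<close>
    have "m - 1 \<le> lo m"
    proof (cases "m = 1")
      case False
      then have "m - 2 \<noteq> m - 1" "m - 2 < m" using m by arith+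
      then have "m - 2 < lo m" using lo_less[of "m - 2" m] lo_left[of "m - 2"] m by simp
      then show ?thesis by simp
    qed simp
    then show ?thesis using crit lo_left[of "m - 1"] m by simp
  qed
  have "m \<le> lo (Suc m)" using lo_less[of m "Suc m"] lo_m m by simp
  \<comment> \<open>Otherwise \<open>lo\<close> would climb strictly from \<open>Suc m\<close> while
    staying below the identity, which forces the excluded value \<open>lo p = p\<close>.\<close>
  moreover have "lo (Suc m) \<noteq> Suc m"
  proof
    assume eq: "lo (Suc m) = Suc m"
    have "lo (Suc m) + (p - Suc m) \<le> lo p"
      by (rule increasing_ge_shift[of "Suc m" N]) (use \<open>m < p\<close> p in \<open>auto intro!: lo_less\<close>)
    then show False using eq bnd(3)[OF p] lo_le[OF p] \<open>m < p\<close> by simp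
  qed
  ultimately have "lo (Suc m) = m" using lo_le[of "Suc m"] m by simp
  then show ?thesis using lo_left[of "m - 1"] lo_m hi m by simp
next
  case False
  \<comment> \<open>In the reversed orientation \<open>below\<close> makes \<open>lo\<close>
    strictly decreasing, so \<open>lo\<close> takes every value up to \<open>N\<close>, including
    the excluded \<open>p\<close>.\<close>
  then have "hi N < hi 0" using above[of 0 N] m by auto
  have lo_less: "lo i < lo j" if "j < i" "i \<le> N" for i j
    using below[OF that] span[of i] that \<open>hi N < hi 0\<close> by auto
  have desc: "lo i = N - i" if "i \<le> N" for i
  proof -
    have loN: "lo i \<le> N" if "i \<le> N" for i using bnd(1,2) that le_trans by blast
    have *: "N - lo j < N - lo (Suc j)" if "j < N" for j
      using lo_less[of j "Suc j"] loN[of j] that by simp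
    show ?thesis
      using increasing_ge_shift[of 0 N "\<lambda>j. N - lo j" i]
        increasing_ge_shift[of i N "\<lambda>j. N - lo j" N] * that loN[of i] by auto
  qed
  show ?thesis using desc[of "N - p"] bnd(3)[of "N - p"] p by simp
qed

section \<open>Comparison of the two lattices\<close>

theorem proposition11p8:
  fixes m n m' n' :: nat
  assumes "m > 0" "n > 0" "m' > 0" "n' > 0"
    and "m + n = m' + n'"
    and "Lmn m n \<in> generated_variety (Lmn m' n')"
  shows "(m, n) = (m', n')"
proof (rule ccontr)
  assume "(m, n) \<noteq> (m', n')"
  then have ne: "m' \<noteq> m" using assms(5) by auto
  define N where "N = m + n"
  let ?g = "generator m n"
  have mN: "0 < m" "m < N" "m' \<le> N" using assms by (auto simp: N_def)
  obtain a where a: "range a \<subseteq> carrier (Lmn m' n')"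
    and refl: "\<And>s t. lterm_vars s \<subseteq> {..N} \<Longrightarrow> lterm_vars t \<subseteq> {..N} \<Longrightarrow>
      eval_hull a s \<subseteq> eval_hull a t \<Longrightarrow> eval_hull ?g s \<subseteq> eval_hull ?g t"
    using quotient_of_sublattice[OF assms(1,2,6)] unfolding N_def by metis
  have car: "eval_hull a t \<in> carrier (Lmn m' n')" for t
    using lterm_value_Lmn[OF a] by blast
  have le_N: "x \<le> N" if "x \<in> eval_hull a t" for x t
    using carrier_Lmn_subset[OF car[of t]] that assms(5) by (auto simp: N_def)
  have conv: "z \<in> eval_hull a t"
    if "x \<in> eval_hull a t" "y \<in> eval_hull a t" "x \<le> z" "z \<le> y" for x y z t
  proof -
    have "z \<le> m' + n'" using le_N[OF that(2)] that(4) assms(5) by (simp add: N_def)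
    then show ?thesis
      using car[of t] that unfolding carrier_Lmn_iff order_convex_def by (meson atLeastAtMost_iff le0)
  qed
  have pred: "m' - 1 \<in> eval_hull a t" if "m' \<in> eval_hull a t" for t
    using car[of t] that by (simp add: carrier_Lmn_iff)
  have fin: "finite (eval_hull a t)" for t
    using carrier_Lmn_subset[OF car] finite_subset by blast
  have "\<exists>b. lterm_vars b \<subseteq> {..N} \<and> eval_hull ?g b = ?g i \<and>
      (\<forall>t. lterm_vars t \<subseteq> {..N} \<longrightarrow> ?g i \<subseteq> eval_hull ?g t \<longrightarrow> eval_hull a b \<subseteq> eval_hull a t)"
    if "i \<le> N" for i
    using least_preimage[OF fin, of "Var i" N ?g] that by (simp, metis)
  then obtain b where b: "\<And>i. i \<le> N \<Longrightarrow> lterm_vars (b i) \<subseteq> {..N}"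
      "\<And>i. i \<le> N \<Longrightarrow> eval_hull ?g (b i) = ?g i"
      "\<And>i t. i \<le> N \<Longrightarrow> lterm_vars t \<subseteq> {..N} \<Longrightarrow> ?g i \<subseteq> eval_hull ?g t \<Longrightarrow>
         eval_hull a (b i) \<subseteq> eval_hull a t"
    by metis
  define A where "A i = eval_hull a (b i)" for i
  \<comment> \<open>A Galois connection: \<open>A i\<close> is the least preimage of
    \<open>?g i\<close> under the homomorphism sending values under \<open>a\<close> to values under
    \<open>?g\<close>.\<close>
  have A_iff: "A i \<subseteq> eval_hull a t \<longleftrightarrow> ?g i \<subseteq> eval_hull ?g t"
    if "i \<le> N" "lterm_vars t \<subseteq> {..N}" for i t
    unfolding A_def using refl[OF b(1)[OF that(1)] that(2)] b(2)[OF that(1)] b(3)[OF that] by metis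
  have A_hull: "A i \<subseteq> hull_Un (A j) (A k) \<longleftrightarrow> ?g i \<subseteq> hull_Un (?g j) (?g k)"
    if "i \<le> N" "j \<le> N" "k \<le> N" for i j k
    using A_iff[OF that(1), of "Join (b j) (b k)"] b(1,2) that by (simp add: A_def)
  have A_ne: "A i \<noteq> {}" if "i \<le> N" for i
  proof
    assume "A i = {}"
    \<comment> \<open>An empty \<open>A i\<close> would put \<open>?g i\<close> inside both
      \<open>{0}\<close> and \<open>{N}\<close>.\<close>
    then have "?g i \<subseteq> hull_Un (?g j) (?g j)" if "j \<le> N" for j
      using A_hull[of i j j] that \<open>i \<le> N\<close> by simp
    from this[of 0] this[of N] show False
      using that mN by (auto simp: generator_def hull_Un_def N_def split: if_splits)
  qed
  define lo where "lo i = Min (A i)" for i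
  define hi where "hi i = Max (A i)" for i
  have mem: "lo i \<in> A i" "hi i \<in> A i" if "i \<le> N" for i
    using A_ne[OF that] fin by (auto simp: A_def lo_def hi_def)
  have A_eq: "A i = {lo i..hi i}" if "i \<le> N" for i
  proof
    show "A i \<subseteq> {lo i..hi i}" using fin by (auto simp: lo_def hi_def A_def)
    show "{lo i..hi i} \<subseteq> A i"
      using conv[OF mem[OF that, unfolded A_def]] by (auto simp: A_def)
  qed
  have bnd: "lo i \<le> hi i" "hi i \<le> N" "lo i \<noteq> m'" if "i \<le> N" for i
  proof -
    show "lo i \<le> hi i" using mem[OF that] A_eq[OF that] by auto
    show "hi i \<le> N" using le_N mem(2)[OF that] by (simp add: A_def)
    show "lo i \<noteq> m'"
    proof
      assume "lo i = m'"
      then have "m' - 1 \<in> A i" using pred mem(1)[OF that] by (simp add: A_def)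
      then show False using A_eq[OF that] \<open>lo i = m'\<close> assms(3) by auto
    qed
  qed
  have hull: "min (lo j) (lo k) \<le> lo i \<and> hi i \<le> max (hi j) (hi k) \<longleftrightarrow> ?g i \<subseteq> hull_Un (?g j) (?g k)"
    if "i \<le> N" "j \<le> N" "k \<le> N" for i j k
    using A_hull[OF that] A_eq bnd(1) that by (simp add: hull_Un_atLeastAtMost)
  have "lo (m - 1) = m - 1 \<and> lo m = m - 1 \<and> lo (Suc m) = m \<and> (\<forall>i\<le>N. hi i = i)"
  proof (rule interval_ranks[OF mN bnd])
    fix i assume "i \<le> N"
    then have "?g i \<subseteq> hull_Un (?g 0) (?g N)"
      using mN by (auto simp: generator_def hull_Un_def N_def)
    then show "min (lo 0) (lo N) \<le> lo i \<and> hi i \<le> max (hi 0) (hi N)"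
      using hull[of i 0 N] \<open>i \<le> N\<close> by simp
  next
    fix i j assume ij: "j < i" "i \<le> N"
    then have "i \<in> ?g i" "i \<notin> hull_Un (?g 0) (?g j)"
      using mN by (auto simp: generator_def hull_Un_def N_def split: if_splits)
    then show "\<not> (min (lo 0) (lo j) \<le> lo i \<and> hi i \<le> max (hi 0) (hi j))"
      using hull[of i 0 j] ij by auto
  next
    fix i k assume ik: "i < k" "k \<le> N" "\<not> (i = m - 1 \<and> k = m)"
    \<comment> \<open>The exempt pair is the one where \<open>?g k\<close> contains \<open>i\<close>
      with \<open>i < k\<close>, since \<open>?g m\<close> contains \<open>m - 1\<close>.\<close>
    then have "i \<in> ?g i" "i \<notin> hull_Un (?g k) (?g N)"
      using mN by (auto simp: generator_def hull_Un_def N_def split: if_splits)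
    then show "\<not> (min (lo k) (lo N) \<le> lo i \<and> hi i \<le> max (hi k) (hi N))"
      using hull[of i k N] ik by auto
  next
    have "?g (m - 1) \<subseteq> hull_Un (?g m) (?g m)"
      using mN by (auto simp: generator_def hull_Un_def)
    then show "lo m \<le> lo (m - 1)" using hull[of "m - 1" m m] mN by simp
  qed (use ne in auto)
  then have "A (m - 1) = {m - 1..m - 1}" "A m = {m - 1..m}" "A (Suc m) = {m..Suc m}"
    using A_eq mN by auto
  moreover from this have "A m \<inter> A (Suc m) = {m..m}" by auto
  \<comment> \<open>The meet of \<open>A m\<close> and \<open>A (Suc m)\<close> contributes the
    point \<open>m\<close>, whereas \<open>?g m\<close> and \<open>?g (Suc m)\<close> are disjoint.
    The inclusion thus transfers to one that fails at \<open>m\<close>.\<close>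
  ultimately have "A m \<subseteq> eval_hull a (Join (b (m - 1)) (Meet (b m) (b (Suc m))))"
    using hull_Un_atLeastAtMost[of "m - 1" "m - 1" m m] by (simp add: A_def[symmetric])
  then have "?g m \<subseteq> hull_Un (?g (m - 1)) (?g m \<inter> ?g (Suc m))"
    using A_iff[of m "Join (b (m - 1)) (Meet (b m) (b (Suc m)))"] b(1,2) mN by simp
  then show False
    using mN by (auto simp: generator_def hull_Un_def split: if_splits)
qed

end
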